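(* Every class of graphs with linear cop-width has linear flip-width. That is, if $\mathcal{G}$ is a class of graphs for which there is a constant $c$ such that $\operatorname{cw}_r(G)\le c\,r$ for every $r\in\mathbb{N}$ and every $G\in\mathcal{G}$, then there is a constant $c'$ such that $\operatorname{fw}_r(G)\le c'\,r$ for every $r\in\mathbb{N}$ and every $G\in\mathcal{G}$.
   Context: All graphs are finite, simple and undirected; $\mathbb{N}=\{1,2,\dots\}$. A graph class is closed under isomorphism. Cop-width game with radius $r$ and width $k$ on $G$: initially the cops occupy a set $C_0\subseteq V(G)$ with $|C_0|\le k$ and the robber chooses a vertex $x_0$. In each round $i\ge1$, the cops announce a new set $C_i\subseteq V(G)$ with $|C_i|\le k$; the robber, knowing $C_i$, moves from $x_{i-1}$ to a vertex $x_i$ along a path in $G$ of length at most $r$ containing no vertex of $C_{i-1}\cap C_i$. The robber is caught if $x_i\in C_i$. $\operatorname{cw}_r(G)$ is the least $k\in\mathbb{N}$ such that the cops can guarantee capture in finitely many rounds. Flips: for $A,B\subseteq V(G)$, flipping between $A$ and $B$ inverts the adjacency of every pair $a,b$ with $a\in A$, $b\in B$. For a partition $\mathcal{P}$ of $V(G)$, a $\mathcal{P}$-flip of $G$ is a graph obtained from $G$ by a sequence of flips between pairs of parts $A,B\in\mathcal{P}$ (possibly $A=B$); a $k$-flip of $G$ is a $\mathcal{P}$-flip for some partition $\mathcal{P}$ with $|\mathcal{P}|\le k$. Flip-width game with radius $r$ and width $k$ on $G$: $G_0=G$ and the runner chooses a vertex $x_0$. In each round $i\ge1$ the flipper announces a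 $k$-flip $G_i$ of $G$; the runner, knowing $G_i$, moves from $x_{i-1}$ to a vertex $x_i$ along a path of length at most $r$ in $G_{i-1}$. The game ends (flipper wins) when $x_i$ is an isolated vertex of $G_i$. $\operatorname{fw}_r(G)$ is the least $k\in\mathbb{N}$ such that the flipper has a strategy guaranteeing that the game ends after finitely many rounds. *)

theory Defs
  imports Complex_Main "HOL-Library.Disjoint_Sets" "Graph_Theory.Graph_Theory"
begin

text \<open>A finite simple undirected graph is a \<open>pair_graph\<close>: a finite, loop-free, symmetric set of
  arcs without parallel arcs; the edge between \<open>u\<close> and \<open>v\<close> is represented by both arcs \<open>(u, v)\<close>
  and \<open>(v, u)\<close>.\<close>

definition graph_class :: "'a pair_pre_digraph set \<Rightarrow> bool" where
  "graph_class \<G> \<longleftrightarrow>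
     (\<forall>G\<in>\<G>. pair_graph G) \<and>
     (\<forall>G\<in>\<G>. \<forall>H :: 'a pair_pre_digraph. digraph_iso (with_proj G) (with_proj H) \<longrightarrow> H \<in> \<G>)"

definition path_avoiding :: "'a pair_pre_digraph \<Rightarrow> nat \<Rightarrow> 'a set \<Rightarrow> 'a \<Rightarrow> 'a \<Rightarrow> bool" where
  "path_avoiding G r S u v \<longleftrightarrow>
     (\<exists>p. vpath p (with_proj G) \<and> hd p = u \<and> last p = v \<and> vwalk_length p \<le> r \<and> set p \<inter> S = {})"


text \<open>In both games a strategy maps the list \<open>[x\<^sub>0, \<dots>, x\<^sub>i\<^sub>-\<^sub>1]\<close> of positions of the opponent so far
  to the move announced in round \<open>i\<close>. The opponent is represented by the infinite sequence \<open>x\<close> of its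
  positions. Quantifying over infinite sequences loses no play: an opponent that has not lost
  yet can always stay where it is, using the path of length 0. In particular, the robber has no legal
  move only if it already stands on a cop.\<close>

definition cop_strategy :: "'a pair_pre_digraph \<Rightarrow> nat \<Rightarrow> ('a list \<Rightarrow> 'a set) \<Rightarrow> bool" where
  "cop_strategy G k \<sigma> \<longleftrightarrow> (\<forall>h. \<sigma> h \<subseteq> pverts G \<and> card (\<sigma> h) \<le> k)"

definition cop_position :: "('a list \<Rightarrow> 'a set) \<Rightarrow> (nat \<Rightarrow> 'a) \<Rightarrow> nat \<Rightarrow> 'a set" where
  "cop_position \<sigma> x i = \<sigma> (map x [0..<i])"

definition robber_play ::
    "'a pair_pre_digraph \<Rightarrow> nat \<Rightarrow> ('a list \<Rightarrow> 'a set) \<Rightarrow> (nat \<Rightarrow> 'a) \<Rightarrow> bool" where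
  "robber_play G r \<sigma> x \<longleftrightarrow>
     x 0 \<in> pverts G \<and>
     (\<forall>i\<ge>1. path_avoiding G r (cop_position \<sigma> x (i - 1) \<inter> cop_position \<sigma> x i) (x (i - 1)) (x i))"

definition cops_win :: "'a pair_pre_digraph \<Rightarrow> nat \<Rightarrow> nat \<Rightarrow> bool" where
  "cops_win G r k \<longleftrightarrow>
     (\<exists>\<sigma>. cop_strategy G k \<sigma> \<and>
          (\<forall>x. robber_play G r \<sigma> x \<longrightarrow> (\<exists>i. x i \<in> cop_position \<sigma> x i)))"

definition cop_width :: "nat \<Rightarrow> 'a pair_pre_digraph \<Rightarrow> nat" where
  "cop_width r G = (LEAST k. 1 \<le> k \<and> cops_win G r k)"


definition flip :: "'a set \<Rightarrow> 'a set \<Rightarrow> 'a pair_pre_digraph \<Rightarrow> 'a pair_pre_digraph" where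
  "flip A B G = G\<lparr>parcs := {(u, v).
     ((u, v) \<in> parcs G) \<noteq> (u \<noteq> v \<and> (u \<in> A \<and> v \<in> B \<or> u \<in> B \<and> v \<in> A))}\<rparr>"

inductive partition_flip ::
    "'a set set \<Rightarrow> 'a pair_pre_digraph \<Rightarrow> 'a pair_pre_digraph \<Rightarrow> bool"
  for P :: "'a set set" and G :: "'a pair_pre_digraph" where
  refl: "partition_flip P G G"
| step: "partition_flip P G H \<Longrightarrow> A \<in> P \<Longrightarrow> B \<in> P \<Longrightarrow> partition_flip P G (flip A B H)"

definition k_flip :: "nat \<Rightarrow> 'a pair_pre_digraph \<Rightarrow> 'a pair_pre_digraph \<Rightarrow> bool" where
  "k_flip k G H \<longleftrightarrow> (\<exists>P. partition_on (pverts G) P \<and> card P \<le> k \<and> partition_flip P G H)"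

definition isolated :: "'a pair_pre_digraph \<Rightarrow> 'a \<Rightarrow> bool" where
  "isolated G v \<longleftrightarrow> v \<in> pverts G \<and> (\<forall>u. (v, u) \<notin> parcs G \<and> (u, v) \<notin> parcs G)"

definition flipper_strategy ::
    "'a pair_pre_digraph \<Rightarrow> nat \<Rightarrow> ('a list \<Rightarrow> 'a pair_pre_digraph) \<Rightarrow> bool" where
  "flipper_strategy G k \<sigma> \<longleftrightarrow> (\<forall>h. k_flip k G (\<sigma> h))"

definition flipped_graph ::
    "'a pair_pre_digraph \<Rightarrow> ('a list \<Rightarrow> 'a pair_pre_digraph) \<Rightarrow> (nat \<Rightarrow> 'a) \<Rightarrow> nat \<Rightarrow>
      'a pair_pre_digraph" where
  "flipped_graph G \<sigma> x i = (if i = 0 then G else \<sigma> (map x [0..<i]))"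

definition runner_play ::
    "'a pair_pre_digraph \<Rightarrow> nat \<Rightarrow> ('a list \<Rightarrow> 'a pair_pre_digraph) \<Rightarrow> (nat \<Rightarrow> 'a) \<Rightarrow> bool" where
  "runner_play G r \<sigma> x \<longleftrightarrow>
     x 0 \<in> pverts G \<and>
     (\<forall>i\<ge>1. path_avoiding (flipped_graph G \<sigma> x (i - 1)) r {} (x (i - 1)) (x i))"

definition flipper_wins :: "'a pair_pre_digraph \<Rightarrow> nat \<Rightarrow> nat \<Rightarrow> bool" where
  "flipper_wins G r k \<longleftrightarrow>
     (\<exists>\<sigma>. flipper_strategy G k \<sigma> \<and>
          (\<forall>x. runner_play G r \<sigma> x \<longrightarrow> (\<exists>i. isolated (flipped_graph G \<sigma> x i) (x i))))"

definition flip_width :: "nat \<Rightarrow> 'a pair_pre_digraph \<Rightarrow> nat" where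
  "flip_width r G = (LEAST k. 1 \<le> k \<and> flipper_wins G r k)"


definition linear_cop_width :: "'a pair_pre_digraph set \<Rightarrow> bool" where
  "linear_cop_width \<G> \<longleftrightarrow>
     (\<exists>c::real. \<forall>r\<ge>1. \<forall>G\<in>\<G>. real (cop_width r G) \<le> c * real r)"

definition linear_flip_width :: "'a pair_pre_digraph set \<Rightarrow> bool" where
  "linear_flip_width \<G> \<longleftrightarrow>
     (\<exists>c::real. \<forall>r\<ge>1. \<forall>G\<in>\<G>. real (flip_width r G) \<le> c * real r)"

end

theory Submission
  imports Defs
begin

text \<open>The flipper imitates the cops: from a cop position \<open>C\<close> it isolates all vertices of \<open>C\<close>, flipping
  along the partition into the singletons of \<open>C\<close> and the classes of vertices outside \<open>C\<close> with
  the same neighbourhood in \<open>C\<close>. It remains to see that the number of these neighbourhoods is linear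
  in \<open>|C|\<close>. Select one vertex for each of them, and let a maximal number of the selected vertices
  serve as subdivision vertices of distinct edges of a graph \<open>M\<close> on \<open>C\<close>; the neighbourhood of every
  other selected vertex is a clique of \<open>M\<close>. As \<open>G\<close> contains a 1-subdivision of \<open>M\<close>, the robber of radius 2
  can exploit any subgraph of \<open>M\<close> of minimum degree at least \<open>cw\<^sub>2(G)\<close>, so \<open>M\<close> is degenerate and
  has at most \<open>2\<^bsup>cw\<^sub>2(G)\<^esup> |C| + 1\<close> cliques, edges included.\<close>

section \<open>Cliques in degenerate graphs\<close>

definition clique :: "'a set set \<Rightarrow> 'a set \<Rightarrow> bool" where
  "clique M X \<longleftrightarrow> (\<forall>u\<in>X. \<forall>w\<in>X. u \<noteq> w \<longrightarrow> {u, w} \<in> M)"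

text \<open>The inequality is strict: for positive \<open>k\<close> the graph on \<open>A\<close>
  with edge set \<open>M\<close> is (k-1)-degenerate in the usual terminology.\<close>

definition degenerate :: "nat \<Rightarrow> 'a set set \<Rightarrow> 'a set \<Rightarrow> bool" where
  "degenerate k M A \<longleftrightarrow>
     (\<forall>A'\<subseteq>A. A' \<noteq> {} \<longrightarrow> (\<exists>v\<in>A'. card {w \<in> A' - {v}. {v, w} \<in> M} < k))"

lemma degenerate_subset: "degenerate k M A \<Longrightarrow> A' \<subseteq> A \<Longrightarrow> degenerate k M A'"
  unfolding degenerate_def by (meson subset_trans)

text \<open>Delete a vertex \<open>v\<close> with fewer than \<open>k\<close> neighbours. The
  cliques through \<open>v\<close> are determined by a set of its neighbours, so at most
  \<open>2 ^ k\<close> are lost. The summand 1 counts the empty clique.\<close>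

lemma card_cliques_le:
  assumes "finite A" "degenerate k M A"
  shows "card {X. X \<subseteq> A \<and> clique M X} \<le> 2 ^ k * card A + 1"
  using assms
proof (induction A rule: finite_psubset_induct)
  case (psubset A)
  show ?case
  proof (cases "A = {}")
    case True
    then have "{X. X \<subseteq> A \<and> clique M X} \<subseteq> {{}}" by auto
    then have "card {X. X \<subseteq> A \<and> clique M X} \<le> card {{} :: 'a set}"
      by (intro card_mono) auto
    then show ?thesis by simp
  next
    case False
    with psubset.prems obtain v where v: "v \<in> A" "card {w \<in> A - {v}. {v, w} \<in> M} < k"
      unfolding degenerate_def by blast
    define W where "W = {w \<in> A - {v}. {v, w} \<in> M}"
    have W: "finite W" "card W < k" using psubset.hyps v by (auto simp: W_def)
    have IH: "card {X. X \<subseteq> A - {v} \<and> clique M X} \<le> 2 ^ k * card (A - {v}) + 1"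
      using v(1) psubset.prems by (intro psubset.IH degenerate_subset[OF psubset.prems]) auto
    have sub: "{X. X \<subseteq> A \<and> clique M X}
        \<subseteq> {X. X \<subseteq> A - {v} \<and> clique M X} \<union> insert v ` Pow W"
    proof
      fix X assume "X \<in> {X. X \<subseteq> A \<and> clique M X}"
      then have X: "X \<subseteq> A" "clique M X" by auto
      show "X \<in> {X. X \<subseteq> A - {v} \<and> clique M X} \<union> insert v ` Pow W"
      proof (cases "v \<in> X")
        case True
        then have "X = insert v (X - {v})" "X - {v} \<in> Pow W"
          using X by (auto simp: W_def clique_def)
        then show ?thesis by blast
      qed (use X in auto)
    qed
    have "card {X. X \<subseteq> A \<and> clique M X}
        \<le> card ({X. X \<subseteq> A - {v} \<and> clique M X} \<union> insert v ` Pow W)"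
      using psubset.hyps W(1) by (intro card_mono[OF _ sub]) auto
    also have "\<dots> \<le> card {X. X \<subseteq> A - {v} \<and> clique M X} + card (insert v ` Pow W)"
      by (rule card_Un_le)
    also have "card (insert v ` Pow W) \<le> 2 ^ card W"
      using card_image_le[of "Pow W" "insert v"] W(1) by (simp add: card_Pow)
    also have "(2::nat) ^ card W \<le> 2 ^ k" using W(2) by simp
    also have "card {X. X \<subseteq> A - {v} \<and> clique M X} + 2 ^ k \<le> 2 ^ k * (card (A - {v}) + 1) + 1"
      using IH by simp
    also have "card (A - {v}) + 1 = card A"
      using card_Suc_Diff1[OF psubset.hyps v(1)] by simp
    finally show ?thesis by simp
  qed
qed

section \<open>Counting distinct neighbourhoods via subdivided edges\<close>

text \<open>\<open>M\<close> is a graph on \<open>A\<close> whose 1-subdivision lies between \<open>A\<close> and \<open>B\<close>, the vertex \<open>g e\<close> subdividing the edge \<open>e\<close>.\<close>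

definition routed :: "'a set \<Rightarrow> 'b set \<Rightarrow> ('b \<Rightarrow> 'a set) \<Rightarrow> 'a set set \<Rightarrow> ('a set \<Rightarrow> 'b) \<Rightarrow> bool" where
  "routed A B N M g \<longleftrightarrow>
     inj_on g M \<and> g ` M \<subseteq> B \<and> (\<forall>e\<in>M. e \<subseteq> A \<and> card e = 2 \<and> e \<subseteq> N (g e))"

lemma maximal_routed:
  assumes "finite B"
  obtains M g where "routed A B N M g"
    "\<And>M' g'. routed A B N M' g' \<Longrightarrow> card M' \<le> card M"
proof -
  have bound: "card M \<le> card B" if "routed A B N M g" for M g
    using that assms unfolding routed_def by (metis card_image card_mono)
  let ?P = "\<lambda>n. \<exists>M g. routed A B N M g \<and> card M = n"
  have "?P 0"
    by (rule exI[of _ "{}"]) (simp add: routed_def)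
  moreover have "\<forall>n. ?P n \<longrightarrow> n \<le> card B" using bound by blast
  ultimately obtain m where "?P m" "\<forall>n. ?P n \<longrightarrow> n \<le> m"
    using Nat.ex_has_greatest_nat[of ?P 0 "card B"] by blast
  then show thesis using that by blast
qed

lemma card_le_if_routed_degenerate:
  assumes "finite A" "finite B" and N: "\<And>b. b \<in> B \<Longrightarrow> N b \<subseteq> A" and inj: "inj_on N B"
    and deg: "\<And>M g. routed A B N M g \<Longrightarrow> degenerate k M A"
  shows "card B \<le> 2 * (2 ^ k * card A + 1)"
proof -
  obtain M g where Mg: "routed A B N M g"
    and max: "\<And>M' g'. routed A B N M' g' \<Longrightarrow> card M' \<le> card M"
    using maximal_routed[OF assms(2)] by blast
  let ?K = "{X. X \<subseteq> A \<and> clique M X}"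
  have finK: "finite ?K" using assms(1) by simp
  have finM: "finite M"
    using Mg assms(2) unfolding routed_def by (meson finite_imageD finite_subset)
  have cl: "N b \<in> ?K" if b: "b \<in> B - g ` M" for b
  proof -
    have "{u, w} \<in> M" if uw: "u \<in> N b" "w \<in> N b" "u \<noteq> w" for u w
    proof (rule ccontr)
      assume new: "{u, w} \<notin> M"
      have "routed A B N (insert {u, w} M) (g({u, w} := b))"
        using Mg b uw new N[of b] unfolding routed_def
        by (auto simp: inj_on_def fun_upd_def)
      then have "card (insert {u, w} M) \<le> card M" by (rule max)
      then show False using new finM by simp
    qed
    then show ?thesis using N b by (auto simp: clique_def)
  qed
  have "M \<subseteq> ?K"
    using Mg by (fastforce simp: routed_def clique_def card_2_iff insert_commute)
  then have "card M \<le> card ?K" using finK by (rule card_mono[rotated])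
  moreover have "card (B - g ` M) \<le> card ?K"
    using cl inj_on_subset[OF inj] finK by (intro card_inj_on_le[of N]) auto
  moreover have "card B \<le> card (g ` M) + card (B - g ` M)"
    using card_Un_le[of "g ` M" "B - g ` M"] card_mono[of "g ` M \<union> (B - g ` M)" B]
      finM assms(2) by auto
  moreover have "card (g ` M) \<le> card M" using finM by (rule card_image_le)
  ultimately have "card B \<le> 2 * card ?K" by linarith
  also have "\<dots> \<le> 2 * (2 ^ k * card A + 1)"
    using card_cliques_le[OF assms(1) deg[OF Mg]] by (rule mult_le_mono2)
  finally show ?thesis .
qed

section \<open>The robber of radius 2 on subdivided graphs\<close>

definition nbs_in :: "'a pair_pre_digraph \<Rightarrow> 'a set \<Rightarrow> 'a \<Rightarrow> 'a set" where
  "nbs_in G C v = {s \<in> C. (v, s) \<in> parcs G}"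

lemma pair_graph_sym: "pair_graph G \<Longrightarrow> (u, v) \<in> parcs G \<Longrightarrow> (v, u) \<in> parcs G"
  using pair_sym_digraph.pair_sym_arcs[of G]
  by (auto simp: pair_graph_def pair_pseudo_graph_def symmetric_def dest: symD)

text \<open>Standing on an unoccupied vertex of \<open>A\<close> is an invariant that the robber can
  always restore; choosing a safe answer to each history in turn yields an infinite play. In
  \<open>step\<close> the two histories enter only through their cop sets.\<close>

lemma robber_escape:
  assumes A: "A \<subseteq> pverts G"
    and start: "\<exists>y\<in>A. y \<notin> \<sigma> []"
    and step: "\<And>v h h'. v \<in> A \<Longrightarrow> v \<notin> \<sigma> h
      \<Longrightarrow> \<exists>y\<in>A. y \<notin> \<sigma> h' \<and> path_avoiding G r (\<sigma> h \<inter> \<sigma> h') v y"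
  shows "\<exists>x. robber_play G r \<sigma> x \<and> (\<forall>i. x i \<notin> cop_position \<sigma> x i)"
proof -
  \<comment> \<open>\<open>\<sigma> h\<close> is the cop set announced when \<open>y\<close> is
    chosen, and \<open>\<sigma> (butlast h)\<close> the one before it; on the empty history there is
    no path to check.\<close>
  define good where "good h y \<longleftrightarrow> y \<in> A \<and> y \<notin> \<sigma> h
      \<and> (h \<noteq> [] \<longrightarrow> path_avoiding G r (\<sigma> (butlast h) \<inter> \<sigma> h) (last h) y)" for h y
  define nxt where "nxt h = (SOME y. good h y)" for h
  define hist where "hist = rec_nat [] (\<lambda>_ h. h @ [nxt h])"
  have hist: "hist 0 = []" "\<And>n. hist (Suc n) = hist n @ [nxt (hist n)]"
    by (simp_all add: hist_def)
  define x where "x n = nxt (hist n)" for n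
  have map_x: "map x [0..<n] = hist n" for n
    by (induction n) (simp_all add: hist x_def)
  have inv: "good (hist n) (x n)" for n
  proof (induction n)
    case 0
    have "\<exists>y. good (hist 0) y" using start by (auto simp: good_def hist(1))
    then show ?case unfolding x_def nxt_def by (rule someI_ex)
  next
    case (Suc n)
    have "\<exists>y\<in>A. y \<notin> \<sigma> (hist (Suc n))
        \<and> path_avoiding G r (\<sigma> (hist n) \<inter> \<sigma> (hist (Suc n))) (x n) y"
      using Suc by (intro step) (auto simp: good_def)
    then have "\<exists>y. good (hist (Suc n)) y"
      by (auto simp: good_def hist(2) x_def)
    then show ?case unfolding x_def nxt_def by (rule someI_ex)
  qed
  have "robber_play G r \<sigma> x"
    unfolding robber_play_def cop_position_def map_x
  proof (intro conjI allI impI)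
    show "x 0 \<in> pverts G" using inv[of 0] A by (auto simp: good_def)
    fix i :: nat assume "1 \<le> i"
    then obtain n where "i = Suc n" by (cases i) auto
    then show "path_avoiding G r (\<sigma> (hist (i - 1)) \<inter> \<sigma> (hist i)) (x (i - 1)) (x i)"
      using inv[of "Suc n"] by (simp add: good_def hist(2) x_def)
  qed
  moreover have "x i \<notin> cop_position \<sigma> x i" for i
    using inv[of i] unfolding cop_position_def map_x good_def by blast
  ultimately show ?thesis by blast
qed

text \<open>In a subdivided graph of minimum degree at least \<open>k\<close>, the robber lives on the branch vertices and
  evades \<open>k\<close> cops: one of them has to land on the robber's vertex, so the remaining ones
  cannot block all of the paths of length 2 leaving it.\<close>

lemma routed_degenerate:
  assumes G: "pair_graph G" and win: "cops_win G 2 k"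
    and A: "A \<subseteq> pverts G" and B: "B \<subseteq> pverts G - A"
    and routed: "routed A B (nbs_in G A) M g"
  shows "degenerate k M A"
proof (rule ccontr)
  assume "\<not> degenerate k M A"
  then obtain A' where A': "A' \<subseteq> A" "A' \<noteq> {}"
    and big: "\<And>v. v \<in> A' \<Longrightarrow> k \<le> card {w \<in> A' - {v}. {v, w} \<in> M}"
    unfolding degenerate_def by (meson linorder_not_less)
  interpret pair_graph G by fact
  have finA': "finite A'" using A' A pair_finite_verts by (meson finite_subset)
  obtain \<sigma> where \<sigma>: "cop_strategy G k \<sigma>"
    "\<And>x. robber_play G 2 \<sigma> x \<Longrightarrow> \<exists>i. x i \<in> cop_position \<sigma> x i"
    using win unfolding cops_win_def by blast
  have card: "card (\<sigma> h) \<le> k" for h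
    using \<sigma>(1) unfolding cop_strategy_def by blast
  have fin: "finite (\<sigma> h)" for h
    using \<sigma>(1) pair_finite_verts unfolding cop_strategy_def by (meson finite_subset)
  \<comment> \<open>\<open>A'\<close> contains a vertex together with at least \<open>k\<close>
    neighbours of it, hence more than \<open>k\<close> vertices.\<close>
  have start: "\<exists>y\<in>A'. y \<notin> \<sigma> []"
  proof (rule ccontr)
    assume "\<not> ?thesis"
    then have "card A' \<le> card (\<sigma> [])" using fin by (intro card_mono) auto
    moreover obtain v where v: "v \<in> A'" using A' by auto
    have "card {w \<in> A' - {v}. {v, w} \<in> M} \<le> card (A' - {v})"
      using finA' by (intro card_mono) auto
    moreover have "card (A' - {v}) < card A'" using v finA' by (rule card_Diff1_less[rotated])
    ultimately show False using big[OF v] card[of "[]"] by linarith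
  qed
  have step: "\<exists>y\<in>A'. y \<notin> T \<and> path_avoiding G 2 (S \<inter> T) v y"
    if v: "v \<in> A'" "v \<notin> S" and T: "finite T" "card T \<le> k" for v S T
  proof (cases "v \<in> T")
    case False
    have "path_avoiding G 2 (S \<inter> T) v v"
      unfolding path_avoiding_def vpath_def vwalk_def
      using v A' A by (intro exI[of _ "[v]"]) auto
    then show ?thesis using v False by blast
  next
    case True
    let ?W = "{w \<in> A' - {v}. {v, w} \<in> M}"
    have "\<exists>w\<in>?W. w \<notin> T \<and> g {v, w} \<notin> T"
    proof (rule ccontr)
      assume blocked: "\<not> ?thesis"
      \<comment> \<open>Each neighbour \<open>w\<close> is sent to a cop blocking the route to it.
        Subdivision vertices are distinct and lie outside \<open>A'\<close>, so \<open>?f\<close> is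
        injective; it misses the cop on \<open>v\<close>, which leaves fewer than \<open>k\<close>
        values.\<close>
      let ?f = "\<lambda>w. if w \<in> T then w else g {v, w}"
      have gB: "g {v, w} \<in> B" if "w \<in> ?W" for w
        using that routed by (auto simp: routed_def)
      have gnA: "g {v, w} \<notin> A'" if "w \<in> ?W" for w
        using gB[OF that] B A'(1) by auto
      have ginj: "w = w'" if "w \<in> ?W" "w' \<in> ?W" "g {v, w} = g {v, w'}" for w w'
        using that routed by (auto simp: routed_def inj_on_def doubleton_eq_iff)
      have inj: "inj_on ?f ?W"
      proof (rule inj_onI)
        fix w w' assume w: "w \<in> ?W" "w' \<in> ?W" "?f w = ?f w'"
        then show "w = w'"
          using gnA[OF w(1)] gnA[OF w(2)] ginj[OF w(1,2)] by (auto split: if_splits)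
      qed
      have "?f w \<in> T - {v}" if "w \<in> ?W" for w
        using blocked that gnA[OF that] v by auto
      then have "?f ` ?W \<subseteq> T - {v}" by (rule image_subsetI)
      with inj have "card ?W \<le> card (T - {v})" by (rule card_inj_on_le) (simp add: T(1))
      moreover have "card (T - {v}) < card T" using T(1) True by (rule card_Diff1_less)
      ultimately show False using big[OF v(1)] T(2) by linarith
    qed
    then obtain w where w: "w \<in> A'" "w \<noteq> v" "{v, w} \<in> M" "w \<notin> T" "g {v, w} \<notin> T" by auto
    define b where "b = g {v, w}"
    have "b \<in> B" "{v, w} \<subseteq> nbs_in G A b" using routed w(3) by (auto simp: routed_def b_def)
    then have b: "b \<in> pverts G" "b \<noteq> v" "b \<noteq> w" "(b, w) \<in> parcs G" "(v, b) \<in> parcs G"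
      using B A' v w pair_graph_sym[OF G, of b v] by (auto simp: nbs_in_def)
    \<comment> \<open>\<open>v\<close> lies outside \<open>S\<close>, while \<open>b\<close> and
      \<open>w\<close> lie outside \<open>T\<close>, so all three avoid the intersection.\<close>
    have "path_avoiding G 2 (S \<inter> T) v w"
      unfolding path_avoiding_def vpath_def vwalk_def
      using v A' A w b by (intro exI[of _ "[v, b, w]"]) (auto simp: b_def)
    then show ?thesis using w by blast
  qed
  have "\<exists>x. robber_play G 2 \<sigma> x \<and> (\<forall>i. x i \<notin> cop_position \<sigma> x i)"
    using subset_trans[OF A'(1) A] start step[OF _ _ fin card] by (rule robber_escape)
  then show False using \<sigma>(2) by blast
qed

lemma card_traces_le:
  assumes G: "pair_graph G" and win: "cops_win G 2 k" and C: "C \<subseteq> pverts G"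
  shows "card (nbs_in G C ` (pverts G - C)) \<le> 2 * (2 ^ k * card C + 1)"
proof -
  interpret pair_graph G by fact
  \<comment> \<open>\<open>B\<close> picks one representative for each neighbourhood in
    \<open>C\<close>.\<close>
  have "\<exists>B\<subseteq>pverts G - C. inj_on (nbs_in G C) B \<and>
      nbs_in G C ` (pverts G - C) = nbs_in G C ` B"
    by (rule subset_image_inj[THEN iffD1, OF order_refl])
  then obtain B where B: "B \<subseteq> pverts G - C" "inj_on (nbs_in G C) B"
    "nbs_in G C ` (pverts G - C) = nbs_in G C ` B"
    by (elim exE conjE)
  have "card B \<le> 2 * (2 ^ k * card C + 1)"
  proof (rule card_le_if_routed_degenerate)
    show "finite C" using C pair_finite_verts by (rule finite_subset)
    show "finite B" using B(1) pair_finite_verts by (meson finite_Diff finite_subset)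
    show "nbs_in G C b \<subseteq> C" for b by (auto simp: nbs_in_def)
    show "degenerate k M C" if "routed C B (nbs_in G C) M g" for M g
      using routed_degenerate[OF G win C B(1) that] .
  qed (fact B)
  then show ?thesis using B(2,3) by (simp add: card_image)
qed

section \<open>Isolating a vertex set by flips\<close>

definition isolate :: "'a set \<Rightarrow> 'a pair_pre_digraph \<Rightarrow> 'a pair_pre_digraph" where
  "isolate C G = G\<lparr>parcs := {(u, v) \<in> parcs G. u \<notin> C \<and> v \<notin> C}\<rparr>"

definition trace_partition :: "'a pair_pre_digraph \<Rightarrow> 'a set \<Rightarrow> 'a set set" where
  "trace_partition G C = (\<lambda>s. {s}) ` C \<union>
     (\<lambda>X. {v \<in> pverts G - C. nbs_in G C v = X}) ` (nbs_in G C ` (pverts G - C))"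

lemma partition_on_trace_partition:
  assumes "C \<subseteq> pverts G" shows "partition_on (pverts G) (trace_partition G C)"
  using assms by (intro partition_onI) (auto simp: trace_partition_def disjnt_def)

lemma card_trace_partition_le:
  assumes G: "pair_graph G" and win: "cops_win G 2 d" and C: "C \<subseteq> pverts G"
  shows "card (trace_partition G C) \<le> card C + 2 * (2 ^ d * card C + 1)"
proof -
  interpret pair_graph G by fact
  let ?S = "(\<lambda>s. {s}) ` C" and ?T = "nbs_in G C ` (pverts G - C)"
  let ?Q = "(\<lambda>X. {v \<in> pverts G - C. nbs_in G C v = X}) ` ?T"
  have fin: "finite C" "finite ?T"
    using finite_subset[OF C pair_finite_verts] pair_finite_verts by auto
  have "card (trace_partition G C) \<le> card ?S + card ?Q"
    unfolding trace_partition_def by (rule card_Un_le)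
  moreover have "card ?S \<le> card C" "card ?Q \<le> card ?T"
    using fin by (auto intro!: card_image_le)
  moreover have "card ?T \<le> 2 * (2 ^ d * card C + 1)" by (rule card_traces_le[OF assms])
  ultimately show ?thesis by linarith
qed

text \<open>Flip \<open>{s}\<close> with the parts in \<open>F\<close> one by one. Each is
  completely joined to \<open>s\<close>, so its flip deletes edges only, and disjointness prevents a
  later flip from restoring any.\<close>

lemma partition_flip_remove_parts:
  assumes "partition_flip P G H" "{s} \<in> P" and "finite F" "F \<subseteq> P" "disjoint F"
    and "\<And>u v. (u, v) \<in> parcs H \<Longrightarrow> (v, u) \<in> parcs H"
    and "\<And>Q v. Q \<in> F \<Longrightarrow> v \<in> Q \<Longrightarrow> (s, v) \<in> parcs H \<and> v \<noteq> s"
  shows "partition_flip P G (H\<lparr>parcs := {(u, v) \<in> parcs H.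
           \<not> (u = s \<and> v \<in> \<Union>F) \<and> \<not> (v = s \<and> u \<in> \<Union>F)}\<rparr>)"
  using assms(3,4,5,7)
proof (induction F)
  case empty
  then show ?case using assms(1) by simp
next
  case (insert Q F)
  let ?H = "\<lambda>F. H\<lparr>parcs := {(u, v) \<in> parcs H.
           \<not> (u = s \<and> v \<in> \<Union>F) \<and> \<not> (v = s \<and> u \<in> \<Union>F)}\<rparr>"
  have dis: "Q \<inter> \<Union>F = {}"
    using insert.prems(2) insert.hyps(2) by (auto simp: pairwise_def disjnt_def)
  have "partition_flip P G (?H F)"
    using insert.prems by (intro insert.IH) (auto simp: pairwise_insert)
  then have "partition_flip P G (flip {s} Q (?H F))"
    using assms(2) insert.prems(1) by (intro partition_flip.step) auto
  moreover have "flip {s} Q (?H F) = ?H (insert Q F)"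
  proof -
    have sQ: "(s, v) \<in> parcs H" "(v, s) \<in> parcs H" "v \<noteq> s" "v \<notin> \<Union>F" if "v \<in> Q" for v
      using insert.prems(3)[of Q v] that assms(6) dis by auto
    have sF: "s \<notin> \<Union>F" using insert.prems(3) by blast
    have "(u, v) \<in> parcs (flip {s} Q (?H F)) \<longleftrightarrow> (u, v) \<in> parcs (?H (insert Q F))" for u v
      using sQ[of u] sQ[of v] sF unfolding flip_def by auto
    then have "parcs (flip {s} Q (?H F)) = parcs (?H (insert Q F))" by auto
    then show ?thesis by (simp add: flip_def)
  qed
  ultimately show ?case by simp
qed

text \<open>The vertices of \<open>C\<close> are isolated one at a time while the partition for all
  of \<open>C\<close> stays fixed. To the next vertex \<open>s\<close>, each part is either
  completely joined or not joined at all: it is a singleton, or its vertices share their neighbours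
  in \<open>C\<close>, and earlier isolations changed no edge between \<open>s\<close> and vertices
  outside \<open>C\<close>.\<close>

lemma partition_flip_isolate:
  assumes G: "pair_graph G" and C: "C \<subseteq> pverts G" and "T \<subseteq> C"
  shows "partition_flip (trace_partition G C) G (isolate T G)"
proof -
  interpret pair_graph G by fact
  have "finite C" using C pair_finite_verts by (rule finite_subset)
  then have "finite T" using assms(3) by (rule finite_subset[rotated])
  then show ?thesis using assms(3)
  proof (induction T)
    case empty
    then show ?case by (simp add: isolate_def partition_flip.refl)
  next
    case (insert s T)
    let ?P = "trace_partition G C" and ?H = "isolate T G"
    define F where "F = {Q \<in> ?P. \<forall>v\<in>Q. (s, v) \<in> parcs ?H}"
    have part: "partition_on (pverts G) ?P" using C by (rule partition_on_trace_partition)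
    have symG: "(u, v) \<in> parcs G \<Longrightarrow> (v, u) \<in> parcs G" for u v
      using G by (rule pair_graph_sym)
    have noloop: "(v, v) \<notin> parcs G" for v using pair_no_loops by fastforce
    have cover: "v \<in> \<Union>F" if sv: "(s, v) \<in> parcs ?H" for v
    proof (cases "v \<in> C")
      case True
      then have "{v} \<in> F" using sv by (auto simp: F_def trace_partition_def)
      then show ?thesis by blast
    next
      case False
      have v: "v \<in> pverts G" using sv in_arcsD2 by (auto simp: isolate_def)
      let ?Q = "{u \<in> pverts G - C. nbs_in G C u = nbs_in G C v}"
      have "?Q \<in> ?P" using v False by (auto simp: trace_partition_def)
      moreover have "(s, u) \<in> parcs ?H" if "u \<in> ?Q" for u
      proof -
        have "s \<in> nbs_in G C v" using sv insert.prems symG by (auto simp: isolate_def nbs_in_def)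
        then have "s \<in> nbs_in G C u" using that by simp
        then show ?thesis
          using sv insert.prems that symG by (auto simp: isolate_def nbs_in_def)
      qed
      ultimately have "?Q \<in> F" unfolding F_def by blast
      then show ?thesis using v False by blast
    qed
    have "partition_flip ?P G (?H\<lparr>parcs := {(u, v) \<in> parcs ?H.
           \<not> (u = s \<and> v \<in> \<Union>F) \<and> \<not> (v = s \<and> u \<in> \<Union>F)}\<rparr>)"
    proof (rule partition_flip_remove_parts)
      show "partition_flip ?P G ?H" using insert by auto
      show "{s} \<in> ?P" using insert.prems by (auto simp: trace_partition_def)
      show "finite F"
        using finite_elements[OF pair_finite_verts part] by (simp add: F_def)
      show "F \<subseteq> ?P" by (auto simp: F_def)
      then show "disjoint F" using part by (meson partition_onD2 pairwise_subset)
      show "(v, u) \<in> parcs ?H" if "(u, v) \<in> parcs ?H" for u v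
        using that symG by (auto simp: isolate_def)
      show "(s, v) \<in> parcs ?H \<and> v \<noteq> s" if "Q \<in> F" "v \<in> Q" for Q v
        using that noloop by (auto simp: F_def isolate_def)
    qed
    moreover have "?H\<lparr>parcs := {(u, v) \<in> parcs ?H.
           \<not> (u = s \<and> v \<in> \<Union>F) \<and> \<not> (v = s \<and> u \<in> \<Union>F)}\<rparr> = isolate (insert s T) G"
    proof -
      have "(v, s) \<in> parcs ?H \<Longrightarrow> v \<in> \<Union>F" for v
        using cover[of v] symG by (auto simp: isolate_def)
      then have "{(u, v) \<in> parcs ?H. \<not> (u = s \<and> v \<in> \<Union>F) \<and> \<not> (v = s \<and> u \<in> \<Union>F)}
          = {(u, v) \<in> parcs ?H. u \<noteq> s \<and> v \<noteq> s}"
        using cover by blast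
      also have "\<dots> = {(u, v) \<in> parcs G. u \<notin> insert s T \<and> v \<notin> insert s T}"
        by (auto simp: isolate_def)
      finally have "{(u, v) \<in> parcs ?H. \<not> (u = s \<and> v \<in> \<Union>F) \<and> \<not> (v = s \<and> u \<in> \<Union>F)}
          = {(u, v) \<in> parcs G. u \<notin> insert s T \<and> v \<notin> insert s T}" .
      then show ?thesis by (simp add: isolate_def)
    qed
    ultimately show ?case by simp
  qed
qed

section \<open>Turning the runner into a robber\<close>

lemma isolated_isolate: "v \<in> pverts G \<Longrightarrow> v \<in> C \<Longrightarrow> isolated (isolate C G) v"
  by (auto simp: isolated_def isolate_def)

text \<open>Every vertex after the first is entered by an arc, and no arc of
  \<open>isolate C G\<close> ends in \<open>C\<close>. Only the first vertex needs an assumption,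
  since a walk of length 0 may stand on \<open>C\<close>.\<close>

lemma vwalk_arcs_avoid:
  assumes "set (vwalk_arcs p) \<subseteq> parcs (isolate C G)" "p \<noteq> []" "hd p \<notin> C"
  shows "set p \<inter> C = {} \<and> set (vwalk_arcs p) \<subseteq> parcs G"
  using assms by (induction p rule: vwalk_arcs.induct) (auto simp: isolate_def)

lemma path_avoiding_isolate:
  assumes "path_avoiding (isolate C G) r {} u v" "u \<notin> C"
  shows "path_avoiding G r C u v"
proof -
  obtain p where p: "vpath p (with_proj (isolate C G))" "hd p = u" "last p = v" "vwalk_length p \<le> r"
    using assms(1) unfolding path_avoiding_def by blast
  have "set p \<inter> C = {} \<and> set (vwalk_arcs p) \<subseteq> parcs G"
    using p assms(2) by (intro vwalk_arcs_avoid) (auto simp: vpath_def vwalk_def)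
  moreover have "pverts (isolate C G) = pverts G" by (simp add: isolate_def)
  ultimately show ?thesis
    using p unfolding path_avoiding_def vpath_def vwalk_def by auto
qed

lemma path_avoiding_mono: "path_avoiding G r S u v \<Longrightarrow> S' \<subseteq> S \<Longrightarrow> path_avoiding G r S' u v"
  unfolding path_avoiding_def by blast

lemma path_avoiding_end: "path_avoiding G r S u v \<Longrightarrow> v \<in> pverts G"
  unfolding path_avoiding_def vpath_def vwalk_def using last_in_set by fastforce

text \<open>The flipper isolates the cops one round late, because the first runner move takes place in \<open>G\<close>
  itself; the runner's vertex \<open>x\<^sub>1\<close> serves as the initial robber position.\<close>

lemma flipper_wins_if_cops_win:
  assumes G: "pair_graph G" and win2: "cops_win G 2 d" and win: "cops_win G r k" and k: "1 \<le> k"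
  shows "flipper_wins G r ((3 + 2 * 2 ^ d) * k)"
proof -
  obtain \<sigma> where \<sigma>: "cop_strategy G k \<sigma>"
    and caught: "\<And>x. robber_play G r \<sigma> x \<Longrightarrow> \<exists>i. x i \<in> cop_position \<sigma> x i"
    using win unfolding cops_win_def by blast
  \<comment> \<open>\<open>tl\<close> drops the start \<open>x 0\<close>: the first flip answers
    \<open>[x 0]\<close> and isolates the initial cop set \<open>\<sigma> []\<close>.\<close>
  define \<tau> where "\<tau> h = isolate (\<sigma> (tl h)) G" for h
  have "k_flip ((3 + 2 * 2 ^ d) * k) G (\<tau> h)" for h
  proof -
    have C: "\<sigma> (tl h) \<subseteq> pverts G" "card (\<sigma> (tl h)) \<le> k"
      using \<sigma> unfolding cop_strategy_def by auto
    have "card (trace_partition G (\<sigma> (tl h)))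
        \<le> card (\<sigma> (tl h)) + 2 * (2 ^ d * card (\<sigma> (tl h)) + 1)"
      by (rule card_trace_partition_le[OF G win2 C(1)])
    \<comment> \<open>Positivity of \<open>k\<close> absorbs the additive 1, so that the bound is a
      multiple of \<open>k\<close>.\<close>
    also have "\<dots> \<le> k + 2 * (2 ^ d * k + k)"
      using C(2) k by (intro add_mono mult_le_mono) auto
    finally have "card (trace_partition G (\<sigma> (tl h))) \<le> (3 + 2 * 2 ^ d) * k"
      by (simp add: algebra_simps)
    then show ?thesis
      unfolding k_flip_def \<tau>_def
      using partition_on_trace_partition[OF C(1)] partition_flip_isolate[OF G C(1) order_refl]
      by blast
  qed
  then have strat: "flipper_strategy G ((3 + 2 * 2 ^ d) * k) \<tau>"
    unfolding flipper_strategy_def by blast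
  have "\<exists>i. isolated (flipped_graph G \<tau> x i) (x i)" if play: "runner_play G r \<tau> x" for x
  proof (rule ccontr)
    assume never: "\<not> ?thesis"
    define y where "y n = x (Suc n)" for n
    have "tl (map x [0..<Suc n]) = map y [0..<n]" for n
      by (rule nth_equalityI) (auto simp: nth_tl y_def simp del: upt_Suc)
    then have fg: "flipped_graph G \<tau> x (Suc n) = isolate (cop_position \<sigma> y n) G" for n
      unfolding flipped_graph_def \<tau>_def cop_position_def by (simp del: upt_Suc)
    have move: "path_avoiding (flipped_graph G \<tau> x n) r {} (x n) (x (Suc n))" for n
      using play[unfolded runner_play_def, THEN conjunct2, rule_format, of "Suc n"] by simp
    have verts: "pverts (flipped_graph G \<tau> x n) = pverts G" for n
      by (cases n) (simp_all add: fg, simp_all add: flipped_graph_def isolate_def)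
    have yV: "y n \<in> pverts G" for n
      using path_avoiding_end[OF move[of n]] by (simp add: verts y_def)
    have free: "y n \<notin> cop_position \<sigma> y n" for n
    proof
      assume "y n \<in> cop_position \<sigma> y n"
      then have "isolated (flipped_graph G \<tau> x (Suc n)) (x (Suc n))"
        using isolated_isolate[OF yV] by (simp add: fg y_def)
      then show False using never by blast
    qed
    have "path_avoiding G r (cop_position \<sigma> y n \<inter> cop_position \<sigma> y (Suc n)) (y n) (y (Suc n))" for n
    proof -
      have "path_avoiding (isolate (cop_position \<sigma> y n) G) r {} (y n) (y (Suc n))"
        using move[of "Suc n"] by (simp add: fg y_def)
      then have "path_avoiding G r (cop_position \<sigma> y n) (y n) (y (Suc n))"
        using free by (rule path_avoiding_isolate)
      \<comment> \<open>The runner avoids the whole previous cop set, which is more than the robber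
        has to.\<close>
      then show ?thesis by (rule path_avoiding_mono) auto
    qed
    then have "path_avoiding G r (cop_position \<sigma> y (i - 1) \<inter> cop_position \<sigma> y i) (y (i - 1)) (y i)"
      if "1 \<le> i" for i
      using that by (cases i) auto
    then have "robber_play G r \<sigma> y"
      unfolding robber_play_def using yV by blast
    then show False using caught free by blast
  qed
  then show ?thesis unfolding flipper_wins_def using strat by blast
qed

section \<open>Comparing the widths\<close>

text \<open>The minimum is attained because cops on all vertices win at once; the added 1 keeps the
  width positive on the empty graph.\<close>

lemma cops_win_cop_width:
  assumes "pair_graph G"
  shows "1 \<le> cop_width r G \<and> cops_win G r (cop_width r G)"
proof -
  have "cop_strategy G (card (pverts G) + 1) (\<lambda>_. pverts G)" unfolding cop_strategy_def by simp
  moreover have "\<exists>i. x i \<in> cop_position (\<lambda>_. pverts G) x i" if "robber_play G r (\<lambda>_. pverts G) x" for x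
    using that unfolding robber_play_def cop_position_def by auto
  ultimately have "1 \<le> card (pverts G) + 1 \<and> cops_win G r (card (pverts G) + 1)"
    unfolding cops_win_def by auto
  then show ?thesis unfolding cop_width_def by (rule LeastI)
qed

text \<open>The factor depends on \<open>G\<close> only through its cop-width at radius 2, so it is
  the same for every \<open>r\<close>.\<close>

lemma flip_width_le_cop_width:
  assumes "pair_graph G"
  shows "flip_width r G \<le> (3 + 2 * 2 ^ cop_width 2 G) * cop_width r G"
proof -
  have "flipper_wins G r ((3 + 2 * 2 ^ cop_width 2 G) * cop_width r G)"
    using cops_win_cop_width[OF assms] by (intro flipper_wins_if_cops_win assms) auto
  then show ?thesis
    unfolding flip_width_def using cops_win_cop_width[OF assms, of r] by (intro Least_le) simp
qed

theorem theorem4: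
  fixes \<G> :: "'a pair_pre_digraph set"
  assumes "graph_class \<G>"
    and "linear_cop_width \<G>"
  shows "linear_flip_width \<G>"
proof -
  obtain c :: real where c: "\<And>r G. 1 \<le> r \<Longrightarrow> G \<in> \<G> \<Longrightarrow> real (cop_width r G) \<le> c * real r"
    using assms(2) unfolding linear_cop_width_def by blast
  \<comment> \<open>The linear bound at radius 2 gives \<open>2 * c\<close>, rounded down because
    widths are integers.\<close>
  define d where "d = nat \<lfloor>2 * c\<rfloor>"
  have "real (flip_width r G) \<le> (3 + 2 * 2 ^ d) * c * real r" if "1 \<le> r" "G \<in> \<G>" for r G
  proof -
    have G: "pair_graph G" using assms(1) that(2) unfolding graph_class_def by blast
    have "cop_width 2 G \<le> d"
      using c[of 2 G] that(2) unfolding d_def by (simp add: le_nat_floor mult.commute)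
    then have "(3 + 2 * 2 ^ cop_width 2 G) * cop_width r G \<le> (3 + 2 * 2 ^ d) * cop_width r G"
      by (intro mult_right_mono add_left_mono mult_left_mono power_increasing) auto
    then have "flip_width r G \<le> (3 + 2 * 2 ^ d) * cop_width r G"
      using flip_width_le_cop_width[OF G, of r] by linarith
    then have "real (flip_width r G) \<le> real ((3 + 2 * 2 ^ d) * cop_width r G)"
      by (rule of_nat_mono)
    also have "\<dots> = (3 + 2 * 2 ^ d) * real (cop_width r G)" by simp
    also have "\<dots> \<le> (3 + 2 * 2 ^ d) * (c * real r)"
      using c[OF that] by (intro mult_left_mono) auto
    finally show ?thesis by (simp add: mult.assoc)
  qed
  then show ?thesis unfolding linear_flip_width_def by blast
qed

end
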